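(* Let $\mathbb{K}$ be $\mathbb{R}$ or $\mathbb{R}_\infty$. For every (finite) system of tropical polynomials in $n$ variables over $\mathbb{K}$ there is a (finite) system of min-plus polynomials over $\mathbb{K}$ over the same set of variables and with the same set of roots in $\mathbb{K}^n$.
   Context: $\mathbb{R}_\infty=\mathbb{R}\cup\{+\infty\}$. Tropical operations on $\mathbb{K}$: $x\oplus y=\min\{x,y\}$, $x\odot y=x+y$. A tropical monomial is $m(\vec x)=c\odot \vec x^{I}$ with $c\in\mathbb{K}$, $I=(i_1,\dots,i_n)\in\mathbb{Z}_{\ge0}^n$ and $\vec x^{I}=i_1x_1+\dots+i_nx_n$ in classical notation (with $0\cdot\infty=0$). A tropical polynomial is a finite tropical sum $f=\min_i m_i$ of monomials with pairwise distinct exponent vectors. A point $\vec a\in\mathbb{K}^n$ is a root of a tropical polynomial $f$ if $\min_i m_i(\vec a)$ is attained on at least two different monomials or is equal to $\infty$. A min-plus polynomial is a pair $(f,g)$ of tropical polynomials; $\vec a\in\mathbb{K}^n$ is a root of $(f,g)$ if $f(\vec a)=g(\vec a)$. A root of a system is a common root of all its members. *)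

theory Defs
  imports "HOL-Analysis.Analysis"
begin

text \<open>
  The semirings \<open>\<real>\<close> and \<open>\<real> \<union> {+\<infinity>}\<close> are carrier sets inside \<^typ>\<open>ereal\<close>: on both carriers
  \<open>min\<close> and \<open>+\<close> of \<^typ>\<open>ereal\<close> are the tropical operations, and \<open>0 * \<infinity> = 0\<close> holds
  in \<^typ>\<open>ereal\<close>.
\<close>

definition R_fin :: "ereal set" where
  "R_fin = range ereal"

definition R_inf :: "ereal set" where
  "R_inf = range ereal \<union> {\<infinity>}"

text \<open>A monomial is a pair of coefficient and exponent vector, a polynomial a set of monomials.\<close>

type_synonym 'n trop_monom = "ereal \<times> (nat ^ 'n)"
type_synonym 'n trop_poly = "'n trop_monom set"

definition monom_eval :: "'n::finite trop_monom \<Rightarrow> ereal ^ 'n \<Rightarrow> ereal" where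
  "monom_eval m a = fst m + (\<Sum>j\<in>UNIV. ereal (real (snd m $ j)) * a $ j)"

text \<open>
  Polynomials are nonempty sums, as a minimum over \<open>\<real>\<close> requires; over \<open>\<real> \<union> {+\<infinity>}\<close>
  the tropical zero is still available as a monomial with coefficient \<open>\<infinity>\<close>.
\<close>

definition trop_polynomial :: "ereal set \<Rightarrow> 'n::finite trop_poly \<Rightarrow> bool" where
  "trop_polynomial K f \<longleftrightarrow>
     finite f \<and> f \<noteq> {} \<and> (\<forall>m\<in>f. fst m \<in> K) \<and> inj_on snd f"

definition poly_eval :: "'n::finite trop_poly \<Rightarrow> ereal ^ 'n \<Rightarrow> ereal" where
  "poly_eval f a = (MIN m\<in>f. monom_eval m a)"

definition trop_root :: "'n::finite trop_poly \<Rightarrow> ereal ^ 'n \<Rightarrow> bool" where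
  "trop_root f a \<longleftrightarrow>
     (\<exists>m\<in>f. \<exists>m'\<in>f. m \<noteq> m' \<and> monom_eval m a = poly_eval f a \<and> monom_eval m' a = poly_eval f a)
     \<or> poly_eval f a = \<infinity>"

definition minplus_polynomial :: "ereal set \<Rightarrow> 'n::finite trop_poly \<times> 'n trop_poly \<Rightarrow> bool" where
  "minplus_polynomial K p \<longleftrightarrow> trop_polynomial K (fst p) \<and> trop_polynomial K (snd p)"

definition minplus_root :: "'n::finite trop_poly \<times> 'n trop_poly \<Rightarrow> ereal ^ 'n \<Rightarrow> bool" where
  "minplus_root p a \<longleftrightarrow> poly_eval (fst p) a = poly_eval (snd p) a"

definition points :: "ereal set \<Rightarrow> (ereal ^ 'n::finite) set" where
  "points K = {a. \<forall>j. a $ j \<in> K}"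

definition trop_system_roots :: "ereal set \<Rightarrow> 'n::finite trop_poly set \<Rightarrow> (ereal ^ 'n) set" where
  "trop_system_roots K S = {a \<in> points K. \<forall>f\<in>S. trop_root f a}"

definition minplus_system_roots ::
    "ereal set \<Rightarrow> ('n::finite trop_poly \<times> 'n trop_poly) set \<Rightarrow> (ereal ^ 'n) set" where
  "minplus_system_roots K T = {a \<in> points K. \<forall>p\<in>T. minplus_root p a}"

end

theory Submission
  imports Defs
begin

text \<open>
  A tropical polynomial \<open>f\<close> vanishes at \<open>a\<close> exactly when no monomial of \<open>f\<close> is indispensable,
  that is, when every single monomial \<open>m\<close> can be made larger without changing \<open>f(a)\<close>.
  ``Larger'' is realised by adding \<open>1\<close> to the coefficient of \<open>m\<close> (\<open>raise_monomial\<close>), so the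
  condition for one \<open>m\<close> is the min-plus equation \<open>f = raise_monomial m f\<close>, and \<open>f\<close> is
  replaced by one such equation for each of its monomials.

  If the minimum is attained twice, then raising one of the two monomials leaves the other one as a
  witness; if the minimum is \<open>\<infinity>\<close>, then all monomials are \<open>\<infinity>\<close> and stay so. Conversely,
  let \<open>m\<close> attain a finite minimum. Raising \<open>m\<close> makes its value strictly larger than the
  minimum, so if the minimum is preserved, then some other monomial attains it
  (\<open>trop_root_iff_raise_monomial\<close>).

  The equations \<open>f = f - {m}\<close> would need a separate treatment of polynomials with
  a single monomial, because the empty minimum is not a polynomial. Raising instead of deleting
  covers this case too: \<open>c = c + 1\<close> holds for \<open>c = \<infinity>\<close> only. It also never leaves
  the carrier, so \<open>\<real>\<close> and \<open>\<real> \<union> {\<infinity>}\<close> need no distinction.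
\<close>

definition raise_monomial :: "'n::finite trop_monom \<Rightarrow> 'n trop_poly \<Rightarrow> 'n trop_poly" where
  "raise_monomial m f = insert (fst m + 1, snd m) (f - {m})"

lemma monom_eval_raise: "monom_eval (fst m + 1, snd m) a = monom_eval m a + 1"
  by (simp add: monom_eval_def add_ac)

lemma sum_ereal_not_MInf:
  fixes g :: "'a \<Rightarrow> ereal"
  assumes "\<And>j. j \<in> A \<Longrightarrow> g j \<noteq> -\<infinity>"
  shows "sum g A \<noteq> -\<infinity>"
  using assms by (induction A rule: infinite_finite_induct) (auto simp: ereal_plus_eq_MInfty)

text \<open>
  In \<^typ>\<open>ereal\<close>, the equation \<open>x + 1 = x\<close> also holds at \<open>-\<infinity>\<close>; this value has to be
  excluded for the strictness of raising.
\<close>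

lemma monom_eval_not_MInf:
  assumes "fst m \<noteq> -\<infinity>" and "\<And>j. a $ j \<noteq> -\<infinity>"
  shows "monom_eval m a \<noteq> -\<infinity>"
proof -
  have "ereal (real (snd m $ j)) * a $ j \<noteq> -\<infinity>" for j
    using assms(2)[of j] by (cases "a $ j") auto
  then have "(\<Sum>j\<in>UNIV. ereal (real (snd m $ j)) * a $ j) \<noteq> -\<infinity>"
    by (intro sum_ereal_not_MInf)
  with assms(1) show ?thesis
    by (simp add: monom_eval_def ereal_plus_eq_MInfty)
qed

lemma poly_eval_le: "finite f \<Longrightarrow> m \<in> f \<Longrightarrow> poly_eval f a \<le> monom_eval m a"
  by (simp add: poly_eval_def)

lemma poly_eval_attained:
  assumes "finite f" "f \<noteq> {}"
  obtains m where "m \<in> f" "monom_eval m a = poly_eval f a"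
proof -
  have "poly_eval f a \<in> (\<lambda>m. monom_eval m a) ` f"
    unfolding poly_eval_def using assms by (intro Min_in) auto
  with that show ?thesis by auto
qed

lemma poly_eval_eqI:
  assumes "finite f" "m \<in> f" "monom_eval m a = v" "\<And>m'. m' \<in> f \<Longrightarrow> v \<le> monom_eval m' a"
  shows "poly_eval f a = v"
  unfolding poly_eval_def using assms by (intro Min_eqI) auto

lemma trop_polynomial_raise_monomial:
  assumes K: "K = R_fin \<or> K = R_inf" and f: "trop_polynomial K f" and m: "m \<in> f"
  shows "trop_polynomial K (raise_monomial m f)"
proof -
  have "x + 1 \<in> K" if "x \<in> K" for x
    using K that by (cases x) (auto simp: R_fin_def R_inf_def one_ereal_def)
  with f m show ?thesis
    by (auto simp: trop_polynomial_def raise_monomial_def inj_on_def)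
qed

lemma trop_root_iff_raise_monomial:
  assumes fin: "finite f" and ne: "f \<noteq> {}"
    and not_MInf: "\<And>m. m \<in> f \<Longrightarrow> monom_eval m a \<noteq> -\<infinity>"
  shows "trop_root f a \<longleftrightarrow> (\<forall>m\<in>f. poly_eval f a = poly_eval (raise_monomial m f) a)"
proof
  let ?v = "poly_eval f a"
  assume root: "trop_root f a"
  show "\<forall>m\<in>f. ?v = poly_eval (raise_monomial m f) a"
  proof
    fix m assume m: "m \<in> f"
    have le_raised: "?v \<le> monom_eval m a + 1"
      using add_mono[OF poly_eval_le[OF fin m], of 0 1 a] by simp
    have "\<exists>m'\<in>raise_monomial m f. monom_eval m' a = ?v"
    proof (cases "?v = \<infinity>")
      case True
      with le_raised show ?thesis
        by (auto simp: raise_monomial_def monom_eval_raise)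
    next
      case False
      with root show ?thesis
        unfolding trop_root_def raise_monomial_def by blast
    qed
    then obtain m' where "m' \<in> raise_monomial m f" "monom_eval m' a = ?v" by blast
    moreover have "?v \<le> monom_eval m'' a" if "m'' \<in> raise_monomial m f" for m''
      using that le_raised poly_eval_le[OF fin, of m'' a]
      by (auto simp: raise_monomial_def monom_eval_raise)
    ultimately show "?v = poly_eval (raise_monomial m f) a"
      using fin poly_eval_eqI[of "raise_monomial m f" m' a ?v]
      by (simp add: raise_monomial_def)
  qed
next
  let ?v = "poly_eval f a"
  assume eq: "\<forall>m\<in>f. ?v = poly_eval (raise_monomial m f) a"
  obtain m where m: "m \<in> f" "monom_eval m a = ?v"
    using poly_eval_attained[OF fin ne] by blast
  obtain m' where m': "m' \<in> raise_monomial m f"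
      "monom_eval m' a = poly_eval (raise_monomial m f) a"
    using poly_eval_attained[of "raise_monomial m f" a] fin by (auto simp: raise_monomial_def)
  show "trop_root f a"
  proof (cases "?v = \<infinity>")
    case True
    then show ?thesis by (simp add: trop_root_def)
  next
    case False
    with not_MInf[OF m(1)] m(2) have "monom_eval m a + 1 \<noteq> ?v"
      by (cases ?v) (auto simp: one_ereal_def)
    then have "monom_eval (fst m + 1, snd m) a \<noteq> ?v"
      by (simp add: monom_eval_raise)
    moreover have m'_min: "monom_eval m' a = ?v"
      using m'(2) eq m(1) by simp
    ultimately have "m' \<in> f - {m}"
      using m'(1) unfolding raise_monomial_def by (metis insertE)
    with m m'_min show ?thesis
      unfolding trop_root_def by blast
  qed
qed

theorem lemma16:
  fixes K :: "ereal set" and S :: "'n::finite trop_poly set"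
  assumes "K = R_fin \<or> K = R_inf"
    and "\<forall>f\<in>S. trop_polynomial K f"
  shows "\<exists>T :: ('n trop_poly \<times> 'n trop_poly) set.
           (finite S \<longrightarrow> finite T) \<and>
           (\<forall>p\<in>T. minplus_polynomial K p) \<and>
           minplus_system_roots K T = trop_system_roots K S"
proof -
  define T where "T = (\<Union>f\<in>S. (\<lambda>m. (f, raise_monomial m f)) ` f)"
  have "finite T" if "finite S"
    using that assms(2) by (auto simp: T_def trop_polynomial_def)
  moreover have "\<forall>p\<in>T. minplus_polynomial K p"
    using assms(2) trop_polynomial_raise_monomial[OF assms(1)]
    by (auto simp: T_def minplus_polynomial_def)
  moreover have "minplus_system_roots K T = trop_system_roots K S"
  proof -
    have not_MInf_K: "-\<infinity> \<notin> K"
      using assms(1) by (auto simp: R_fin_def R_inf_def)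
    have "(\<forall>p\<in>T. minplus_root p a) \<longleftrightarrow> (\<forall>f\<in>S. trop_root f a)" if "a \<in> points K" for a
    proof -
      have "trop_root f a \<longleftrightarrow> (\<forall>m\<in>f. poly_eval f a = poly_eval (raise_monomial m f) a)"
        if "f \<in> S" for f
      proof (rule trop_root_iff_raise_monomial)
        have f: "trop_polynomial K f"
          using assms(2) that by blast
        then show "finite f" "f \<noteq> {}"
          by (simp_all add: trop_polynomial_def)
        show "monom_eval m a \<noteq> -\<infinity>" if "m \<in> f" for m
          using f that \<open>a \<in> points K\<close> not_MInf_K
          by (intro monom_eval_not_MInf) (auto simp: trop_polynomial_def points_def, metis+)
      qed
      then show ?thesis
        by (simp add: T_def minplus_root_def)
    qed
    then show ?thesis
      by (auto simp: minplus_system_roots_def trop_system_roots_def)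
  qed
  ultimately show ?thesis by blast
qed

end
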